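(* Let $\mathbb{G}=(G,\mathcal{O}_{\mathrm{ref}},<)$ be an ordered, oriented graph. The map $R\mapsto\mathcal{O}_R$ is a bijection between the regions of the bigraphical arrangement $\Sigma_{(G,\mathcal{O}_{\mathrm{ref}})}(A^<)$ with exponential parameters and the cycle neutral partial orientations of $\mathbb{G}$.
   Context: Graphs are finite, undirected and connected; loops and multiple edges are allowed. A reference orientation $\mathcal{O}_{\mathrm{ref}}$ assigns to each edge $e=\{u,v\}$ one of $(u,v),(v,u)$. Each edge has two formal orientations $e^+$ (directed as $\mathcal{O}_{\mathrm{ref}}(e)$) and $e^-$ (directed oppositely), distinct even for loops; $e^{\varepsilon}=(u,v)$ means directed from $u$ to $v$. $\mathbb{E}(G)$ is the set of all $e^{+},e^-$. An ordered, oriented graph is $(G,\mathcal{O}_{\mathrm{ref}},<)$ with $<$ a total order on $E(G)$. A partial orientation is a subset $\mathcal{O}\subseteq\mathbb{E}(G)$ containing at most one of $e^+,e^-$ for each $e$; $e$ is neutral if neither is in $\mathcal{O}$, and oriented otherwise. A directed cycle $\overrightarrow{Cy}$ is a list $v_1,e_1^{\delta_1},\dots,v_k,e_k^{\delta_k}$ ($k\ge1$), up to rotation, with distinct edges $e_i$ and $e_i^{\delta_i}=(v_i,v_{i+1})$ (indices mod $k$). It is a potential cycle of a partial orientation $\mathcal{O}$ if $e_i^{-\delta_i}\notin\mathcal{O}$ for all $i$ (so oriented edges agree with the cycle, and neutral edges are allowed). A partial orientation is cycle neutral if the $<$-minimum edge in each of its potential cycles is neutral. Exponential parameters: if $e_1<e_2<\cdots<e_m$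 are the edges of $G$, set $a^<_{e_i^+}=a^<_{e_i^-}=(1/2)^i$. Let $U\subseteq\mathbb{R}^{V(G)}$ be the subspace where $\sum_{v}x_v=0$. The bigraphical arrangement $\Sigma_{(G,\mathcal{O}_{\mathrm{ref}})}(A^<)$ is the arrangement in $U$ of the hyperplanes $H_{e^+}\cap U$ and $H_{e^-}\cap U$ for all non-loop edges $e$, where for $e^{\varepsilon}=(u,v)$, $H_{e^{\varepsilon}}$ is the hyperplane $x_v-x_u=a^<_{e^{\varepsilon}}$. A region is a connected component of the complement in $U$ of the union of the hyperplanes. For a region $R$, $\mathcal{O}_R$ is the partial orientation containing, for each non-loop edge $e$ and $\varepsilon\in\{+,-\}$ with $e^{\varepsilon}=(u,v)$, the element $e^{\varepsilon}$ iff $x_v-x_u>a^<_{e^{\varepsilon}}$ on $R$; edges for which $R$ lies between $H_{e^+}$ and $H_{e^-}$ are neutral, and all loops are neutral. *)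

theory Defs
  imports "HOL-Analysis.Analysis" "HOL-Library.Uprod"
begin

text \<open>
  The vertex set of a graph is the whole (finite, nonempty) type \<open>'v\<close>, so that
  \<open>\<real>\<^bsup>V(G)\<^esup>\<close> is the Euclidean space \<open>real ^ 'v\<close>. The edges form an explicit set of
  labels, so multiple edges, loops and the empty edge set are all possible.
\<close>

record ('v, 'e) multigraph =
  edges :: "'e set"
  ends :: "'e \<Rightarrow> 'v uprod"

record ('v, 'e) ordered_oriented_multigraph = "('v, 'e) multigraph" +
  ref_orientation :: "'e \<Rightarrow> 'v \<times> 'v"
  edge_less :: "'e rel"

definition connected_multigraph :: "('v, 'e, 'x) multigraph_scheme \<Rightarrow> bool" where
  "connected_multigraph G \<longleftrightarrow>
     (\<forall>u v. (u, v) \<in> {(x, y). \<exists>e\<in>edges G. ends G e = Upair x y}\<^sup>*)"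

definition ordered_oriented_graph ::
    "('v::finite, 'e) ordered_oriented_multigraph \<Rightarrow> bool" where
  "ordered_oriented_graph G \<longleftrightarrow>
     finite (edges G) \<and> connected_multigraph G \<and>
     (\<forall>e\<in>edges G. \<forall>u v. ref_orientation G e = (u, v) \<longrightarrow> ends G e = Upair u v) \<and>
     strict_linear_order_on (edges G) (edge_less G)"

definition is_loop :: "('v, 'e, 'x) multigraph_scheme \<Rightarrow> 'e \<Rightarrow> bool" where
  "is_loop G e \<longleftrightarrow> (\<exists>v. ends G e = Upair v v)"

text \<open>
  The formal orientations \<open>e\<^sup>+\<close> and \<open>e\<^sup>-\<close> are the pairs \<open>(e, Plus)\<close> and \<open>(e, Minus)\<close>,
  which are distinct even if \<open>e\<close> is a loop.
\<close>

datatype sign = Plus | Minus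

fun opposite :: "sign \<Rightarrow> sign" where
  "opposite Plus = Minus"
| "opposite Minus = Plus"

type_synonym 'e oriented_edge = "'e \<times> sign"

fun direction :: "('v, 'e) ordered_oriented_multigraph \<Rightarrow> 'e oriented_edge \<Rightarrow> 'v \<times> 'v" where
  "direction G (e, Plus) = ref_orientation G e"
| "direction G (e, Minus) = prod.swap (ref_orientation G e)"

definition formal_orientations ::
    "('v, 'e) ordered_oriented_multigraph \<Rightarrow> 'e oriented_edge set" where
  "formal_orientations G = edges G \<times> UNIV"

definition partial_orientation ::
    "('v, 'e) ordered_oriented_multigraph \<Rightarrow> 'e oriented_edge set \<Rightarrow> bool" where
  "partial_orientation G \<O> \<longleftrightarrow>
     \<O> \<subseteq> formal_orientations G \<and>
     (\<forall>e\<in>edges G. \<not> ((e, Plus) \<in> \<O> \<and> (e, Minus) \<in> \<O>))"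

definition neutral :: "'e oriented_edge set \<Rightarrow> 'e \<Rightarrow> bool" where
  "neutral \<O> e \<longleftrightarrow> (e, Plus) \<notin> \<O> \<and> (e, Minus) \<notin> \<O>"

text \<open>
  The list \<open>[(v\<^sub>1, e\<^sub>1, \<delta>\<^sub>1), \<dots>, (v\<^sub>k, e\<^sub>k, \<delta>\<^sub>k)]\<close> represents a directed cycle. Rotations
  are not identified: everything below that refers to directed cycles is invariant
  under rotation.
\<close>

definition directed_cycle ::
    "('v, 'e) ordered_oriented_multigraph \<Rightarrow> ('v \<times> 'e oriented_edge) list \<Rightarrow> bool" where
  "directed_cycle G C \<longleftrightarrow>
     length C \<ge> 1 \<and>
     snd ` set C \<subseteq> formal_orientations G \<and>
     distinct (map (\<lambda>(v, e, \<delta>). e) C) \<and>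
     (\<forall>i<length C. direction G (snd (C ! i)) = (fst (C ! i), fst (C ! (Suc i mod length C))))"

definition cycle_edges :: "('v \<times> 'e oriented_edge) list \<Rightarrow> 'e set" where
  "cycle_edges C = (\<lambda>(v, e, \<delta>). e) ` set C"

definition potential_cycle ::
    "('v, 'e) ordered_oriented_multigraph \<Rightarrow> 'e oriented_edge set \<Rightarrow>
     ('v \<times> 'e oriented_edge) list \<Rightarrow> bool" where
  "potential_cycle G \<O> C \<longleftrightarrow>
     directed_cycle G C \<and> (\<forall>(v, e, \<delta>)\<in>set C. (e, opposite \<delta>) \<notin> \<O>)"

definition is_min_edge ::
    "('v, 'e) ordered_oriented_multigraph \<Rightarrow> 'e set \<Rightarrow> 'e \<Rightarrow> bool" where
  "is_min_edge G F e \<longleftrightarrow> e \<in> F \<and> (\<forall>f\<in>F. f \<noteq> e \<longrightarrow> (e, f) \<in> edge_less G)"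

definition cycle_neutral ::
    "('v, 'e) ordered_oriented_multigraph \<Rightarrow> 'e oriented_edge set \<Rightarrow> bool" where
  "cycle_neutral G \<O> \<longleftrightarrow>
     (\<forall>C e. potential_cycle G \<O> C \<longrightarrow> is_min_edge G (cycle_edges C) e \<longrightarrow> neutral \<O> e)"

text \<open>
  If the edges are \<open>e\<^sub>1 < \<dots> < e\<^sub>m\<close>, then \<open>edge_index G e\<^sub>i = i\<close> (counting from 1).
\<close>

definition edge_index :: "('v, 'e) ordered_oriented_multigraph \<Rightarrow> 'e \<Rightarrow> nat" where
  "edge_index G e = card {f \<in> edges G. f = e \<or> (f, e) \<in> edge_less G}"

definition exponential_parameters ::
    "('v, 'e) ordered_oriented_multigraph \<Rightarrow> 'e oriented_edge \<Rightarrow> real" where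
  "exponential_parameters G d = (1/2) ^ edge_index G (fst d)"

definition zero_sum_space :: "(real ^ 'v) set" where
  "zero_sum_space = {x. (\<Sum>v\<in>UNIV. x $ v) = 0}"

definition displacement ::
    "('v, 'e) ordered_oriented_multigraph \<Rightarrow> 'e oriented_edge \<Rightarrow> real ^ 'v \<Rightarrow> real" where
  "displacement G d x = (case direction G d of (u, v) \<Rightarrow> x $ v - x $ u)"

definition hyperplane ::
    "('v, 'e) ordered_oriented_multigraph \<Rightarrow> ('e oriented_edge \<Rightarrow> real) \<Rightarrow>
     'e oriented_edge \<Rightarrow> (real ^ 'v) set" where
  "hyperplane G a d = {x. displacement G d x = a d}"

definition bigraphical_arrangement ::
    "('v, 'e) ordered_oriented_multigraph \<Rightarrow> ('e oriented_edge \<Rightarrow> real) \<Rightarrow>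
     (real ^ 'v) set set" where
  "bigraphical_arrangement G a =
     {hyperplane G a (e, \<epsilon>) \<inter> zero_sum_space | e \<epsilon>. e \<in> edges G \<and> \<not> is_loop G e}"

definition regions :: "(real ^ 'v) set set \<Rightarrow> (real ^ 'v) set set" where
  "regions \<A> = components (zero_sum_space - \<Union>\<A>)"

definition region_orientation ::
    "('v, 'e) ordered_oriented_multigraph \<Rightarrow> ('e oriented_edge \<Rightarrow> real) \<Rightarrow>
     (real ^ 'v) set \<Rightarrow> 'e oriented_edge set" where
  "region_orientation G a R =
     {(e, \<epsilon>). e \<in> edges G \<and> \<not> is_loop G e \<and> (\<forall>x\<in>R. displacement G (e, \<epsilon>) x > a (e, \<epsilon>))}"

end

theory Submission imports Defs begin

text \<open>
  A point realises a partial orientation \<open>\<O>\<close> iff it solves the strict difference constraints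
  \<open>x\<^sub>v - x\<^sub>u > w d\<close> for all \<open>d = (u, v)\<close> whose opposite is not in \<open>\<O>\<close>, where \<open>w d\<close> is the
  parameter of \<open>d\<close> if \<open>d \<in> \<O>\<close> and its negative otherwise. The closed trails of these
  constraints are the potential cycles of \<open>\<O>\<close>, and the system is solvable iff \<open>w\<close> has
  negative sum on each of them. As \<open>(1/2)\<^sup>i\<close> exceeds the sum of any later powers up to
  \<open>(1/2)\<^sup>m\<close>, the sign of that sum is the sign of the term of the minimal edge, which is
  negative iff this edge is neutral.
\<close>

section \<open>Solvability of difference constraints\<close>

definition flip :: "'e oriented_edge \<Rightarrow> 'e oriented_edge" where
  "flip d = (fst d, opposite (snd d))"

lemma opposite_opposite [simp]: "opposite (opposite s) = s"
  by (cases s) auto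

lemma flip_flip [simp]: "flip (flip d) = d"
  by (simp add: flip_def)

lemma fst_flip [simp]: "fst (flip d) = fst d"
  by (simp add: flip_def)

lemma direction_flip: "direction G (flip d) = prod.swap (direction G d)"
  by (cases d; cases "snd d") (auto simp: flip_def)

lemma displacement_flip: "displacement G (flip d) x = - displacement G d x"
  by (simp add: displacement_def direction_flip split: prod.splits)

lemma flip_mem_formal_orientations [simp]:
  "flip d \<in> formal_orientations G \<longleftrightarrow> d \<in> formal_orientations G"
  by (cases d) (auto simp: formal_orientations_def flip_def)

lemma same_edge_cases:
  assumes "fst d' = fst d"
  obtains "d' = d" | "d' = flip d"
  using assms by (cases d; cases d'; cases "snd d"; cases "snd d'") (auto simp: flip_def)

lemma finite_formal_orientations:
  assumes "finite (edges G)"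
  shows "finite (formal_orientations G)"
proof -
  have "(UNIV :: sign set) = {Plus, Minus}"
    by (auto intro: sign.exhaust)
  then have "finite (UNIV :: sign set)"
    by (metis finite.emptyI finite.insertI)
  with assms show ?thesis
    by (simp add: formal_orientations_def)
qed

section \<open>Walks and directed cycles\<close>

text \<open>Unlike a \<open>directed_cycle\<close>, a walk stores no vertices and may be empty, so
  it can be cut and concatenated freely.\<close>

fun walk :: "('v, 'e) ordered_oriented_multigraph \<Rightarrow> 'v \<Rightarrow> 'e oriented_edge list \<Rightarrow> 'v \<Rightarrow> bool" where
  "walk G u [] v \<longleftrightarrow> u = v"
| "walk G u (d # p) v \<longleftrightarrow> fst (direction G d) = u \<and> walk G (snd (direction G d)) p v"

lemma walk_append: "walk G u (p @ q) v \<longleftrightarrow> (\<exists>w. walk G u p w \<and> walk G w q v)"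
  by (induction p arbitrary: u) auto

lemma walk_fst_nth_0:
  assumes "walk G u p v" "p \<noteq> []"
  shows "fst (direction G (p ! 0)) = u"
  using assms by (cases p) auto

lemma walk_snd_nth:
  assumes "walk G u p v" "i < length p"
  shows "snd (direction G (p ! i)) = (if Suc i < length p then fst (direction G (p ! Suc i)) else v)"
  using assms
proof (induction p arbitrary: u i)
  case (Cons d p)
  show ?case
  proof (cases i)
    case 0
    with Cons.prems show ?thesis by (cases p) auto
  next
    case (Suc j)
    with Cons show ?thesis by auto
  qed
qed simp

text \<open>Bridge from weights of closed trails to cycle neutrality: the missing vertices are
  restored as the tails of the edges, and closedness supplies the wrap-around from the last edge to
  the first.\<close>

lemma directed_cycle_of_closed_walk:
  assumes "walk G u p u" "p \<noteq> []" "set p \<subseteq> formal_orientations G" "distinct (map fst p)"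
  shows "directed_cycle G (map (\<lambda>d. (fst (direction G d), d)) p)"
  unfolding directed_cycle_def
proof (intro conjI allI impI)
  let ?C = "map (\<lambda>d. (fst (direction G d), d)) p"
  show "1 \<le> length ?C"
    using assms(2) by (cases p) auto
  show "snd ` set ?C \<subseteq> formal_orientations G"
    using assms(3) by auto
  show "distinct (map (\<lambda>(v, e, \<delta>). e) ?C)"
    using assms(4) by (simp add: comp_def case_prod_beta)
  fix i assume "i < length ?C"
  then have i: "i < length p" by simp
  have j: "Suc i mod length p < length p"
    using assms(2) by simp
  have "snd (direction G (p ! i)) = fst (direction G (p ! (Suc i mod length p)))"
  proof (cases "Suc i < length p")
    case False
    with i have "Suc i = length p" by simp
    then show ?thesis
      using walk_snd_nth[OF assms(1) i] walk_fst_nth_0[OF assms(1,2)] by simp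
  qed (use walk_snd_nth[OF assms(1) i] in simp)
  then show "direction G (snd (?C ! i)) = (fst (?C ! i), fst (?C ! (Suc i mod length ?C)))"
    using i j by (simp add: prod_eq_iff)
qed

text \<open>
  The solution is the maximal weight of a trail ending at the given vertex. The second hypothesis
  covers the extension of a trail by the reverse of one of its edges.
\<close>

lemma difference_constraints_solvable:
  fixes G :: "('v::finite, 'e) ordered_oriented_multigraph" and w :: "'e oriented_edge \<Rightarrow> real"
  assumes fin: "finite A"
    and closed: "\<And>u p. walk G u p u \<Longrightarrow> set p \<subseteq> A \<Longrightarrow> distinct (map fst p) \<Longrightarrow> sum_list (map w p) \<le> 0"
    and reverse: "\<And>d. d \<in> A \<Longrightarrow> flip d \<in> A \<Longrightarrow> w d + w (flip d) \<le> 0"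
  shows "\<exists>x. \<forall>d\<in>A. w d \<le> displacement G d x"
proof -
  \<comment> \<open>The start of a trail is left free, so \<open>[]\<close> lies in every
    \<open>T v\<close> and the maximum is over a nonempty set. Distinctness of the edges makes that
    set finite.\<close>
  define T where "T v = {p. (\<exists>u. walk G u p v) \<and> set p \<subseteq> A \<and> distinct (map fst p)}" for v
  define W where "W p = sum_list (map w p)" for p
  define X where "X v = Max (W ` T v)" for v
  have finT: "finite (T v)" for v
    by (rule finite_subset[OF _ finite_subset_distinct[OF fin]])
      (auto simp: T_def distinct_map)
  have le_X: "W p \<le> X v" if "p \<in> T v" for p v
    unfolding X_def using that finT by (intro Max_ge) auto
  have "w d \<le> X v - X u" if d: "d \<in> A" and dir: "direction G d = (u, v)" for d u v
  proof -
    have "[] \<in> T u"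
      by (auto simp: T_def)
    then have "X u \<in> W ` T u"
      unfolding X_def using finT by (intro Max_in) auto
    then obtain p where p: "p \<in> T u" and Xu: "X u = W p"
      by auto
    then obtain s where s: "walk G s p u" and pA: "set p \<subseteq> A" and dist: "distinct (map fst p)"
      by (auto simp: T_def)
    have "W p + w d \<le> X v"
    proof (cases "fst d \<in> fst ` set p")
      case False
      then have "p @ [d] \<in> T v"
        using s pA dist d dir by (auto simp: T_def walk_append)
      from le_X[OF this] show ?thesis
        by (simp add: W_def)
    next
      case True
      then obtain d' where d': "d' \<in> set p" and "fst d' = fst d"
        by (metis imageE)
      then obtain p1 p2 where p_eq: "p = p1 @ d' # p2"
        by (meson split_list)
      with s obtain t where t: "walk G s p1 t" "fst (direction G d') = t"
          "walk G (snd (direction G d')) p2 u"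
        by (auto simp: walk_append)
      from \<open>fst d' = fst d\<close> show ?thesis
      proof (cases rule: same_edge_cases)
        \<comment> \<open>Here \<open>p2 @ [d]\<close> is a closed trail at \<open>v\<close>;
          removing it from \<open>p @ [d]\<close> leaves \<open>p1 @ [d]\<close>, which weighs at
          least as much.\<close>
        case 1
        have "p1 @ [d] \<in> T v"
          using t dir pA dist by (auto simp: T_def walk_append p_eq 1)
        moreover have "W (p2 @ [d]) \<le> 0"
          unfolding W_def
          by (rule closed[of v]) (use t dir pA dist in \<open>auto simp: walk_append p_eq 1\<close>)
        ultimately show ?thesis
          using le_X[of "p1 @ [d]" v] by (simp add: W_def p_eq 1)
      next
        \<comment> \<open>Here \<open>p1\<close> already ends at \<open>v\<close> and
          \<open>p2\<close> is closed at \<open>u\<close>. Dropping \<open>p2\<close> and the pair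
          \<open>flip d\<close>, \<open>d\<close> does not lower the weight.\<close>
        case 2
        have "p1 \<in> T v"
          using t dir pA dist by (auto simp: T_def p_eq 2 direction_flip)
        moreover have "W p2 \<le> 0"
          unfolding W_def
          by (rule closed[of u]) (use t dir pA dist in \<open>auto simp: p_eq 2 direction_flip\<close>)
        moreover have "w d + w (flip d) \<le> 0"
          using reverse[OF d] d' pA 2 by auto
        ultimately show ?thesis
          using le_X[of p1 v] by (simp add: W_def p_eq 2)
      qed
    qed
    then show ?thesis
      using Xu by simp
  qed
  then have "\<forall>d\<in>A. w d \<le> displacement G d (\<chi> v. X v)"
    by (auto simp: displacement_def split: prod.splits)
  then show ?thesis ..
qed

section \<open>Exponential parameters\<close>

lemma exponential_parameters_pos: "exponential_parameters G d > 0"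
  by (simp add: exponential_parameters_def)

lemma exponential_parameters_flip [simp]:
  "exponential_parameters G (flip d) = exponential_parameters G d"
  by (simp add: exponential_parameters_def)

lemma edge_index_less:
  assumes "ordered_oriented_graph G" "e \<in> edges G" "f \<in> edges G" "(e, f) \<in> edge_less G"
  shows "edge_index G e < edge_index G f"
proof -
  have lin: "trans (edge_less G)" "irrefl (edge_less G)" "finite (edges G)"
    using assms(1) by (auto simp: ordered_oriented_graph_def strict_linear_order_on_def)
  then have nle: "(f, e) \<notin> edge_less G" "f \<noteq> e"
    using assms(4) by (meson irrefl_def transD)+
  show ?thesis
    unfolding edge_index_def
  proof (rule psubset_card_mono)
    show "{g \<in> edges G. g = e \<or> (g, e) \<in> edge_less G} \<subset> {g \<in> edges G. g = f \<or> (g, f) \<in> edge_less G}"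
      using assms nle lin(1) by (auto dest: transD)
  qed (use lin in simp)
qed

lemma inj_on_edge_index:
  assumes "ordered_oriented_graph G"
  shows "inj_on (edge_index G) (edges G)"
proof (rule inj_onI, rule ccontr)
  fix e f assume *: "e \<in> edges G" "f \<in> edges G" "edge_index G e = edge_index G f" "e \<noteq> f"
  then have "(e, f) \<in> edge_less G \<or> (f, e) \<in> edge_less G"
    using assms by (auto simp: ordered_oriented_graph_def strict_linear_order_on_def total_on_def)
  with * edge_index_less[OF assms] show False
    by fastforce
qed

lemma edge_index_le_card:
  assumes "ordered_oriented_graph G"
  shows "edge_index G e \<le> card (edges G)"
  unfolding edge_index_def
  using assms by (intro card_mono) (auto simp: ordered_oriented_graph_def)

lemma ex_min_edge:
  assumes G: "ordered_oriented_graph G" and F: "F \<subseteq> edges G" "F \<noteq> {}"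
  obtains e where "is_min_edge G F e"
proof -
  have tot: "total_on (edges G) (edge_less G)"
    using G by (auto simp: ordered_oriented_graph_def strict_linear_order_on_def)
  obtain e where e: "e \<in> F" "\<And>f. f \<in> F \<Longrightarrow> edge_index G e \<le> edge_index G f"
    using ex_has_least_nat[of "\<lambda>e. e \<in> F" _ "edge_index G"] F(2) by blast
  have "(e, f) \<in> edge_less G" if "f \<in> F" "f \<noteq> e" for f
    using that e F(1) tot edge_index_less[OF G, of f e]
    by (meson leD subsetD total_on_def)
  with e that show ?thesis
    by (auto simp: is_min_edge_def)
qed

lemma sum_powers_half: "i \<le> m \<Longrightarrow> (\<Sum>j\<in>{i<..m}. (1/2) ^ j) = (1/2) ^ i - (1/2 :: real) ^ m"
proof (induction m)
  case (Suc m)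
  show ?case
  proof (cases "i = Suc m")
    case False
    with Suc.prems have "i \<le> m" by simp
    moreover from this have "{i<..Suc m} = insert (Suc m) {i<..m}" by auto
    ultimately show ?thesis
      using Suc.IH by simp
  qed simp
qed simp

text \<open>The later edges have distinct indices in
  \<open>{edge_index G e<..card (edges G)}\<close>, so a geometric sum bounds them. The subtracted
  last power is kept because it gives strictness, and a quantitative gap, later.\<close>

lemma sum_later_parameters_le:
  assumes G: "ordered_oriented_graph G" and F: "F \<subseteq> edges G" and e: "is_min_edge G F e"
  shows "(\<Sum>f\<in>F - {e}. (1/2) ^ edge_index G f)
           \<le> (1/2 :: real) ^ edge_index G e - (1/2) ^ card (edges G)"
proof -
  have eF: "e \<in> F" and less: "\<And>f. f \<in> F - {e} \<Longrightarrow> (e, f) \<in> edge_less G"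
    using e by (auto simp: is_min_edge_def)
  have inj: "inj_on (edge_index G) (F - {e})"
    using inj_on_edge_index[OF G] F by (meson Diff_subset inj_on_subset)
  have "(\<Sum>f\<in>F - {e}. (1/2) ^ edge_index G f) = (\<Sum>j\<in>edge_index G ` (F - {e}). (1/2 :: real) ^ j)"
    by (simp add: sum.reindex[OF inj])
  also have "\<dots> \<le> (\<Sum>j\<in>{edge_index G e<..card (edges G)}. (1/2) ^ j)"
  proof (rule sum_mono2)
    show "edge_index G ` (F - {e}) \<subseteq> {edge_index G e<..card (edges G)}"
      using edge_index_le_card[OF G] edge_index_less[OF G] less eF F by fastforce
  qed auto
  also have "\<dots> = (1/2) ^ edge_index G e - (1/2) ^ card (edges G)"
    by (rule sum_powers_half) (rule edge_index_le_card[OF G])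
  finally show ?thesis .
qed

lemma sum_list_exponential_parameters:
  assumes "distinct (map fst p)"
  shows "sum_list (map (exponential_parameters G) p) = (\<Sum>f\<in>fst ` set p. (1/2) ^ edge_index G f)"
proof -
  have "sum_list (map (exponential_parameters G) p)
      = sum_list (map (\<lambda>f. (1/2) ^ edge_index G f) (map fst p))"
    by (simp add: exponential_parameters_def[abs_def] comp_def)
  also have "\<dots> = (\<Sum>f\<in>fst ` set p. (1/2) ^ edge_index G f)"
    using assms by (subst sum_list_distinct_conv_sum_set) simp_all
  finally show ?thesis .
qed

text \<open>The minimal edge outweighs all others together. The factor 2 arises since reversing the
  sign of one term changes a sum by twice that term; both directions of the characterisation use
  this form.\<close>

lemma cycle_parameters_le:
  assumes G: "ordered_oriented_graph G"
    and p: "distinct (map fst p)" "set p \<subseteq> formal_orientations G"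
    and d: "d \<in> set p" "is_min_edge G (fst ` set p) (fst d)"
  shows "sum_list (map (exponential_parameters G) p)
           \<le> 2 * exponential_parameters G d - (1/2) ^ card (edges G)"
proof -
  have "fst ` set p \<subseteq> edges G"
    using p(2) by (auto simp: formal_orientations_def)
  from sum_later_parameters_le[OF G this d(2)]
  have "(\<Sum>f\<in>fst ` set p. (1/2) ^ edge_index G f)
      \<le> 2 * (1/2 :: real) ^ edge_index G (fst d) - (1/2) ^ card (edges G)"
    using d(1) by (subst sum.remove[of _ "fst d"]) auto
  then show ?thesis
    by (simp add: sum_list_exponential_parameters[OF p(1)] exponential_parameters_def)
qed

section \<open>Realisable orientations\<close>

text \<open>Pointwise counterpart of \<open>region_orientation\<close>. In an ordered, oriented
  graph loops have displacement 0, below every parameter, and thus come out neutral.\<close>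

definition realises ::
    "('v, 'e) ordered_oriented_multigraph \<Rightarrow> real ^ 'v \<Rightarrow> 'e oriented_edge set \<Rightarrow> bool" where
  "realises G x \<O> \<longleftrightarrow> \<O> \<subseteq> formal_orientations G \<and>
     (\<forall>d\<in>formal_orientations G. displacement G d x \<noteq> exponential_parameters G d \<and>
        (d \<in> \<O> \<longleftrightarrow> displacement G d x > exponential_parameters G d))"

text \<open>Meant for \<open>d\<close> with \<open>flip d\<close> outside \<open>\<O>\<close>: that
  \<open>flip d\<close> stays below its parameter says that \<open>d\<close> exceeds the negated
  parameter, and membership of \<open>d\<close> raises this bound to the parameter itself.\<close>

definition lower_bound ::
    "('v, 'e) ordered_oriented_multigraph \<Rightarrow> 'e oriented_edge set \<Rightarrow> 'e oriented_edge \<Rightarrow> real" where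
  "lower_bound G \<O> d =
     (if d \<in> \<O> then exponential_parameters G d else - exponential_parameters G d)"

lemma partial_orientation_flip:
  assumes "partial_orientation G \<O>" "d \<in> \<O>"
  shows "flip d \<notin> \<O>"
  using assms
  by (cases d; cases "snd d") (auto simp: partial_orientation_def formal_orientations_def flip_def)

lemma lower_bound_less_displacement:
  assumes "realises G x \<O>" "d \<in> formal_orientations G" "flip d \<notin> \<O>"
  shows "lower_bound G \<O> d < displacement G d x"
proof -
  have "displacement G (flip d) x \<noteq> exponential_parameters G (flip d)"
       "\<not> displacement G (flip d) x > exponential_parameters G (flip d)"
    using assms flip_mem_formal_orientations unfolding realises_def by blast+
  moreover have "d \<in> \<O> \<Longrightarrow> displacement G d x > exponential_parameters G d"
    using assms by (auto simp: realises_def)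
  ultimately show ?thesis
    by (auto simp: displacement_flip lower_bound_def)
qed

lemma realisesI:
  assumes po: "partial_orientation G \<O>"
    and lower: "\<And>d. d \<in> formal_orientations G \<Longrightarrow> flip d \<notin> \<O> \<Longrightarrow> lower_bound G \<O> d < displacement G d x"
  shows "realises G x \<O>"
  unfolding realises_def
proof (intro conjI ballI)
  show "\<O> \<subseteq> formal_orientations G"
    using po by (simp add: partial_orientation_def)
  fix d assume d: "d \<in> formal_orientations G"
  have above: "displacement G d x > exponential_parameters G d" if "d \<in> \<O>"
    using lower[OF d] partial_orientation_flip[OF po that] that by (simp add: lower_bound_def)
  have below: "displacement G d x < exponential_parameters G d" if "d \<notin> \<O>"
  proof -
    \<comment> \<open>The upper bound for \<open>d\<close> is the lower bound for its reverse,
      whether or not \<open>flip d\<close> belongs to \<open>\<O>\<close>.\<close>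
    have "- exponential_parameters G d \<le> lower_bound G \<O> (flip d)"
      using exponential_parameters_pos[of G d] by (auto simp: lower_bound_def)
    also have "\<dots> < displacement G (flip d) x"
      using lower[of "flip d"] d that by simp
    finally show ?thesis
      by (simp add: displacement_flip)
  qed
  show "displacement G d x \<noteq> exponential_parameters G d"
    using above below by (cases "d \<in> \<O>") auto
  show "d \<in> \<O> \<longleftrightarrow> displacement G d x > exponential_parameters G d"
    using above below by (cases "d \<in> \<O>") auto
qed

section \<open>Realised orientations are cycle neutral\<close>

lemma sum_Suc_mod:
  fixes g :: "nat \<Rightarrow> 'a::comm_monoid_add"
  shows "(\<Sum>i<n. g (Suc i mod n)) = (\<Sum>i<n. g i)"
proof (cases n)
  case (Suc m)
  have "(\<Sum>i<Suc m. g (Suc i mod Suc m)) = (\<Sum>i<m. g (Suc i mod Suc m)) + g 0"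
    by simp
  also have "(\<Sum>i<m. g (Suc i mod Suc m)) = (\<Sum>i<m. g (Suc i))"
    by (intro sum.cong) auto
  also have "\<dots> + g 0 = (\<Sum>i<Suc m. g i)"
    by (simp add: sum.lessThan_Suc_shift add.commute del: sum.lessThan_Suc)
  finally show ?thesis
    using Suc by simp
qed simp

text \<open>The potential differences telescope around the cycle, since the cyclic shift of indices
  preserves the sum.\<close>

lemma sum_displacement_directed_cycle:
  assumes "directed_cycle G C"
  shows "sum_list (map (\<lambda>d. displacement G d x) (map snd C)) = 0"
proof -
  have "sum_list (map (\<lambda>d. displacement G d x) (map snd C))
      = (\<Sum>i<length C. displacement G (snd (C ! i)) x)"
    by (simp add: sum_list_sum_nth lessThan_atLeast0)
  also have "\<dots> = (\<Sum>i<length C. x $ fst (C ! (Suc i mod length C)) - x $ fst (C ! i))"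
    using assms by (intro sum.cong) (auto simp: directed_cycle_def displacement_def)
  also have "\<dots> = 0"
    by (simp add: sum_subtractf sum_Suc_mod[of "\<lambda>i. x $ fst (C ! i)"])
  finally show ?thesis .
qed

lemma cycle_edges_eq: "cycle_edges C = fst ` set (map snd C)"
  by (auto simp: cycle_edges_def image_image case_prod_beta)

text \<open>If the minimal edge of a potential cycle were oriented, it would agree with the cycle
  and contribute more than its parameter. The other edges cannot compensate, so the displacements
  around the cycle would have positive sum instead of 0.\<close>

lemma realises_imp_cycle_neutral:
  assumes G: "ordered_oriented_graph G" and x: "realises G x \<O>"
  shows "cycle_neutral G \<O>"
  unfolding cycle_neutral_def
proof (intro allI impI, rule ccontr)
  fix C e
  assume C: "potential_cycle G \<O> C" and e: "is_min_edge G (cycle_edges C) e" and "\<not> neutral \<O> e"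
  define p where "p = map snd C"
  have dc: "directed_cycle G C"
    using C by (simp add: potential_cycle_def)
  have p: "distinct (map fst p)" "set p \<subseteq> formal_orientations G"
    using dc by (auto simp: p_def directed_cycle_def comp_def case_prod_beta')
  have "e \<in> fst ` set p" and min: "is_min_edge G (fst ` set p) e"
    using e by (auto simp: p_def cycle_edges_eq is_min_edge_def)
  then obtain d where d: "d \<in> set p" "fst d = e"
    by auto
  have flip: "flip d' \<notin> \<O>" if "d' \<in> set p" for d'
    using that C by (auto simp: p_def potential_cycle_def flip_def)
  have "d \<in> \<O>"
    using \<open>\<not> neutral \<O> e\<close> flip[OF d(1)] d(2)
    by (cases d; cases "snd d") (auto simp: neutral_def flip_def)
  let ?a = "exponential_parameters G"
  \<comment> \<open>All lower bounds are estimated by the negated parameter, except at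
    \<open>d\<close>, where the correction \<open>2 * ?a d\<close> turns this into the parameter
    itself.\<close>
  have mono: "(if d' = d then 2 * ?a d else 0) - ?a d' \<le> lower_bound G \<O> d'" for d'
    using \<open>d \<in> \<O>\<close> exponential_parameters_pos[of G d'] by (auto simp: lower_bound_def)
  have dist: "distinct p"
    using p(1) by (simp add: distinct_map)
  have "0 < 2 * ?a d - sum_list (map ?a p)"
  proof -
    have "(0 :: real) < (1/2) ^ card (edges G)"
      by simp
    with cycle_parameters_le[OF G p d(1)] min show ?thesis
      unfolding d(2) by linarith
  qed
  also have "2 * ?a d = (\<Sum>d'\<in>set p. if d' = d then 2 * ?a d else 0)"
    using d(1) by simp
  also have "\<dots> - sum_list (map ?a p) = (\<Sum>d'\<in>set p. (if d' = d then 2 * ?a d else 0) - ?a d')"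
    using dist by (simp only: sum_list_distinct_conv_sum_set sum_subtractf)
  also have "\<dots> \<le> (\<Sum>d'\<in>set p. lower_bound G \<O> d')"
    by (rule sum_mono) (rule mono)
  also have "\<dots> \<le> (\<Sum>d'\<in>set p. displacement G d' x)"
    using lower_bound_less_displacement[OF x] p(2) flip
    by (intro sum_mono less_imp_le) blast
  also have "\<dots> = sum_list (map (\<lambda>d. displacement G d x) p)"
    using dist by (simp add: sum_list_distinct_conv_sum_set)
  also have "\<dots> = 0"
    unfolding p_def by (rule sum_displacement_directed_cycle[OF dc])
  finally show False by simp
qed

text \<open>The displacements of \<open>e\<close> in its two directions are negatives of each other,
  so they cannot both exceed a positive parameter.\<close>

lemma realises_imp_partial_orientation:
  assumes "realises G x \<O>"
  shows "partial_orientation G \<O>"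
  unfolding partial_orientation_def
proof (intro conjI ballI notI)
  show "\<O> \<subseteq> formal_orientations G"
    using assms by (simp add: realises_def)
  fix e assume "e \<in> edges G" and both: "(e, Plus) \<in> \<O> \<and> (e, Minus) \<in> \<O>"
  have Minus: "(e, Minus) = flip (e, Plus)"
    by (simp add: flip_def)
  have "exponential_parameters G d < displacement G d x" if "d \<in> \<O>" for d
    using that assms by (auto simp: realises_def)
  from this[of "(e, Plus)"] this[of "(e, Minus)"] both
  show False
    using exponential_parameters_pos[of G "(e, Plus)"] unfolding Minus
    by (auto simp: displacement_flip)
qed

section \<open>Cycle neutral orientations are realised\<close>

text \<open>Raising each lower bound by a small \<open>\<epsilon>\<close> turns the strict
  constraints into weak ones. Cycle neutrality makes the minimal edge of each closed trail
  contribute negatively, which leaves room for the added \<open>\<epsilon>\<close>.\<close>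

lemma cycle_neutral_imp_realises:
  fixes G :: "('v::finite, 'e) ordered_oriented_multigraph"
  assumes G: "ordered_oriented_graph G"
    and po: "partial_orientation G \<O>" and cn: "cycle_neutral G \<O>"
  shows "\<exists>x. realises G x \<O>"
proof -
  let ?a = "exponential_parameters G"
  let ?m = "card (edges G)"
  have fin: "finite (edges G)"
    using G by (simp add: ordered_oriented_graph_def)
  define A where "A = {d \<in> formal_orientations G. flip d \<notin> \<O>}"
  \<comment> \<open>A trail has at most \<open>?m\<close> edges, so the total increase is at most
    the gap \<open>(1/2) ^ ?m\<close> of \<open>cycle_parameters_le\<close>. The \<open>+ 1\<close>
    keeps the denominator positive for an empty edge set.\<close>
  define \<epsilon> :: real where "\<epsilon> = (1/2) ^ ?m / (real ?m + 1)"
  have \<epsilon>_pos: "\<epsilon> > 0" and m\<epsilon>: "real ?m * \<epsilon> \<le> (1/2) ^ ?m" and \<epsilon>_le: "\<epsilon> \<le> (1/2) ^ ?m"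
    by (auto simp: \<epsilon>_def divide_simps mult_le_cancel_left)
  define w where "w d = lower_bound G \<O> d + \<epsilon>" for d
  have "\<exists>x. \<forall>d\<in>A. w d \<le> displacement G d x"
  proof (rule difference_constraints_solvable)
    show "finite A"
      using finite_formal_orientations[OF fin] by (simp add: A_def)
  next
    fix d assume "d \<in> A" "flip d \<in> A"
    then have "d \<notin> \<O>" "flip d \<notin> \<O>"
      by (auto simp: A_def)
    \<comment> \<open>For a neutral edge the two raised bounds add up to
      \<open>2 * \<epsilon> - 2 * ?a d\<close>.\<close>
    moreover have "\<epsilon> \<le> ?a d"
    proof -
      have "(1/2) ^ ?m \<le> ?a d"
        unfolding exponential_parameters_def
        by (rule power_decreasing[OF edge_index_le_card[OF G]]) auto
      with \<epsilon>_le show ?thesis by simp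
    qed
    ultimately show "w d + w (flip d) \<le> 0"
      by (simp add: w_def lower_bound_def)
  next
    fix u p
    assume p: "walk G u p u" "set p \<subseteq> A" "distinct (map fst p)"
    show "sum_list (map w p) \<le> 0"
    proof (cases "p = []")
      case False
      have form: "set p \<subseteq> formal_orientations G"
        using p(2) by (auto simp: A_def)
      then have edges: "fst ` set p \<subseteq> edges G"
        by (auto simp: formal_orientations_def)
      define C where "C = map (\<lambda>d. (fst (direction G d), d)) p"
      have snd_C: "map snd C = p"
        by (simp add: C_def comp_def)
      have "potential_cycle G \<O> C"
        unfolding potential_cycle_def
        using directed_cycle_of_closed_walk[OF p(1) False form p(3)] p(2)
        by (auto simp: C_def A_def flip_def)
      obtain e where e: "is_min_edge G (fst ` set p) e"
        using ex_min_edge[OF G edges] False by auto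
      then obtain d where d: "d \<in> set p" "fst d = e"
        by (auto simp: is_min_edge_def)
      have "is_min_edge G (cycle_edges C) e"
        using e by (simp only: cycle_edges_eq snd_C)
      with cn \<open>potential_cycle G \<O> C\<close> have "neutral \<O> e"
        by (simp add: cycle_neutral_def)
      then have "d \<notin> \<O>"
        using d(2) by (cases d; cases "snd d") (auto simp: neutral_def)
      \<comment> \<open>Now the parameters bound the contributions from above, with the sign
        reversed at the neutral minimal edge.\<close>
      have mono: "lower_bound G \<O> d' \<le> ?a d' - (if d' = d then 2 * ?a d else 0)" for d'
        using \<open>d \<notin> \<O>\<close> exponential_parameters_pos[of G d'] by (auto simp: lower_bound_def)
      have dist: "distinct p"
        using p(3) by (simp add: distinct_map)
      have "length p = card (fst ` set p)"
        using p(3) by (metis distinct_card length_map set_map)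
      also have "\<dots> \<le> ?m"
        using edges fin by (rule card_mono[rotated])
      finally have len: "real (length p) * \<epsilon> \<le> real ?m * \<epsilon>"
        using \<epsilon>_pos by (intro mult_right_mono) auto
      have "sum_list (map w p) = (\<Sum>d'\<in>set p. lower_bound G \<O> d') + real (length p) * \<epsilon>"
        using dist
        by (simp add: w_def sum_list_distinct_conv_sum_set sum.distrib distinct_card)
      also have "(\<Sum>d'\<in>set p. lower_bound G \<O> d')
          \<le> (\<Sum>d'\<in>set p. ?a d' - (if d' = d then 2 * ?a d else 0))"
        by (rule sum_mono) (rule mono)
      also have "\<dots> = sum_list (map ?a p) - 2 * ?a d"
        using dist d(1) by (simp add: sum_subtractf sum_list_distinct_conv_sum_set)
      also have "\<dots> \<le> - ((1/2) ^ ?m)"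
        using cycle_parameters_le[OF G p(3) form d(1)] e d(2) by simp
      finally show ?thesis
        using len m\<epsilon> by simp
    qed simp
  qed
  then obtain x where x: "\<And>d. d \<in> A \<Longrightarrow> w d \<le> displacement G d x"
    by blast
  have "realises G x \<O>"
  proof (rule realisesI[OF po])
    fix d assume "d \<in> formal_orientations G" "flip d \<notin> \<O>"
    then have "w d \<le> displacement G d x"
      by (intro x) (simp add: A_def)
    then show "lower_bound G \<O> d < displacement G d x"
      using \<epsilon>_pos by (simp add: w_def)
  qed
  then show ?thesis ..
qed

text \<open>Subtracting the mean from all coordinates leaves every displacement unchanged.\<close>

lemma realises_zero_sum:
  fixes G :: "('v::finite, 'e) ordered_oriented_multigraph"
  assumes "realises G x \<O>"
  shows "\<exists>y\<in>zero_sum_space. realises G y \<O>"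
proof
  define y where "y = (\<chi> v. x $ v - (\<Sum>u\<in>UNIV. x $ u) / real CARD('v))"
  have "displacement G d y = displacement G d x" for d
    by (simp add: displacement_def y_def split: prod.splits)
  then show "realises G y \<O>"
    using assms by (simp add: realises_def)
  show "y \<in> zero_sum_space"
    by (simp add: zero_sum_space_def y_def sum_subtractf)
qed

section \<open>Regions\<close>

lemma displacement_linear: "linear (displacement G d)"
  by (rule linearI) (auto simp: displacement_def algebra_simps split: prod.splits)

lemma loop_displacement:
  assumes "ordered_oriented_graph G" "d \<in> formal_orientations G" "is_loop G (fst d)"
  shows "displacement G d x = 0"
proof -
  obtain e s where d: "d = (e, s)" by (cases d)
  obtain u v where uv: "ref_orientation G e = (u, v)" by (cases "ref_orientation G e")
  then have "ends G e = Upair u v"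
    using assms by (auto simp: ordered_oriented_graph_def d formal_orientations_def)
  with assms(3) have "u = v"
    by (auto simp: is_loop_def d)
  with uv show ?thesis
    by (cases s) (auto simp: displacement_def d)
qed

text \<open>The arrangement ranges over non-loop edges and \<open>realises\<close> over all formal
  orientations. They agree because a loop has displacement 0, which differs from its positive
  parameter.\<close>

lemma mem_complement_iff:
  assumes "ordered_oriented_graph G"
  shows "x \<in> zero_sum_space - \<Union>(bigraphical_arrangement G (exponential_parameters G)) \<longleftrightarrow>
    x \<in> zero_sum_space \<and>
    (\<forall>d\<in>formal_orientations G. displacement G d x \<noteq> exponential_parameters G d)"
    (is "x \<in> ?U \<longleftrightarrow> _")
proof -
  have "displacement G d x \<noteq> exponential_parameters G d"
    if "d \<in> formal_orientations G" "is_loop G (fst d)" for d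
    using loop_displacement[OF assms that, of x] exponential_parameters_pos[of G d] by simp
  then have "(\<forall>d\<in>formal_orientations G. displacement G d x \<noteq> exponential_parameters G d) \<longleftrightarrow>
      (\<forall>e \<epsilon>. e \<in> edges G \<longrightarrow> \<not> is_loop G e \<longrightarrow>
        displacement G (e, \<epsilon>) x \<noteq> exponential_parameters G (e, \<epsilon>))"
    by (force simp: formal_orientations_def)
  moreover have "x \<in> \<Union>(bigraphical_arrangement G (exponential_parameters G)) \<longleftrightarrow>
      x \<in> zero_sum_space \<and> (\<exists>e \<epsilon>. e \<in> edges G \<and> \<not> is_loop G e \<and>
        displacement G (e, \<epsilon>) x = exponential_parameters G (e, \<epsilon>))"
    unfolding bigraphical_arrangement_def hyperplane_def by blast
  ultimately show ?thesis
    by blast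
qed

text \<open>Both endpoints lie strictly on the same side of the hyperplane, and a linear functional
  maps the segment onto the interval between its endpoint values.\<close>

lemma segment_avoids_hyperplanes:
  assumes "d \<in> formal_orientations G" "realises G x \<O>" "realises G y \<O>" "z \<in> closed_segment x y"
  shows "displacement G d z \<noteq> exponential_parameters G d"
proof -
  let ?h = "displacement G d"
  have seg: "?h z \<in> closed_segment (?h x) (?h y)"
    using assms(4) closed_segment_linear_image[OF displacement_linear[of G d], of x y] by blast
  have "?h x > exponential_parameters G d \<and> ?h y > exponential_parameters G d \<or>
        ?h x < exponential_parameters G d \<and> ?h y < exponential_parameters G d"
    using assms(1-3) unfolding realises_def by (metis linorder_neqE)
  with seg show ?thesis
    by (auto simp: closed_segment_eq_real_ivl split: if_splits)
qed

lemma subspace_zero_sum_space: "subspace (zero_sum_space :: (real ^ 'v::finite) set)"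
  by (auto simp: subspace_def zero_sum_space_def sum.distrib simp flip: sum_distrib_left)

lemma connected_component_if_same_orientation:
  fixes G :: "('v::finite, 'e) ordered_oriented_multigraph"
  assumes "ordered_oriented_graph G"
    and x: "x \<in> zero_sum_space" "realises G x \<O>" and y: "y \<in> zero_sum_space" "realises G y \<O>"
  shows "connected_component
    (zero_sum_space - \<Union>(bigraphical_arrangement G (exponential_parameters G))) x y"
  unfolding connected_component_def
proof (intro exI conjI)
  have "closed_segment x y \<subseteq> zero_sum_space"
    using subspace_imp_convex[OF subspace_zero_sum_space] x(1) y(1)
    by (rule closed_segment_subset[rotated 2])
  then show "closed_segment x y
      \<subseteq> zero_sum_space - \<Union>(bigraphical_arrangement G (exponential_parameters G))"
    using mem_complement_iff[OF assms(1)] segment_avoids_hyperplanes[OF _ x(2) y(2)] by blast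
qed auto

text \<open>On a connected region the continuous displacement never takes the parameter as a value,
  so by the intermediate value property it stays on one side. Hence the condition on all points of
  \<open>R\<close> can be tested at \<open>x\<close> alone.\<close>

lemma region_realises:
  fixes G :: "('v::finite, 'e) ordered_oriented_multigraph"
  assumes G: "ordered_oriented_graph G"
    and R: "R \<in> regions (bigraphical_arrangement G (exponential_parameters G))"
    and x: "x \<in> R"
  shows "realises G x (region_orientation G (exponential_parameters G) R)"
proof -
  let ?a = "exponential_parameters G"
  let ?U = "zero_sum_space - \<Union>(bigraphical_arrangement G ?a)"
  have RU: "R \<subseteq> ?U" and conn: "connected R"
    using R by (auto simp: regions_def in_components_subset in_components_connected)
  have ne: "displacement G d y \<noteq> ?a d" if "d \<in> formal_orientations G" "y \<in> R" for d y
    using mem_complement_iff[OF G] RU that by blast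
  have const: "displacement G d y > ?a d"
    if d: "d \<in> formal_orientations G" and y: "y \<in> R" and gt: "displacement G d x > ?a d" for d y
  proof (rule ccontr)
    assume "\<not> displacement G d y > ?a d"
    moreover have "connected (displacement G d ` R)"
      by (intro connected_continuous_image conn linear_continuous_on
          linear_conv_bounded_linear[THEN iffD1] displacement_linear)
    ultimately have "?a d \<in> displacement G d ` R"
      using connectedD_interval[of "displacement G d ` R" "displacement G d y" "displacement G d x" "?a d"]
        x y gt by auto
    with ne[OF d] show False by (metis imageE)
  qed
  have "\<not> is_loop G (fst d)" if "d \<in> formal_orientations G" "displacement G d x > ?a d" for d
    using loop_displacement[OF G that(1), of x] that(2) exponential_parameters_pos[of G d] by auto
  then have "d \<in> region_orientation G ?a R \<longleftrightarrow> displacement G d x > ?a d"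
    if "d \<in> formal_orientations G" for d
    using that const[OF that] x
    by (cases d) (fastforce simp: region_orientation_def formal_orientations_def)
  moreover have "region_orientation G ?a R \<subseteq> formal_orientations G"
    by (auto simp: region_orientation_def formal_orientations_def)
  ultimately show ?thesis
    using ne x by (auto simp: realises_def)
qed

lemma realises_unique:
  assumes "realises G x \<O>" "realises G x \<O>'"
  shows "\<O> = \<O>'"
  using assms unfolding realises_def by blast

section \<open>The bijection between regions and orientations\<close>

theorem proposition4p3:
  fixes G :: "('v::finite, 'e) ordered_oriented_multigraph"
  assumes "ordered_oriented_graph G"
  shows "bij_betw (region_orientation G (exponential_parameters G))
           (regions (bigraphical_arrangement G (exponential_parameters G)))
           {\<O>. partial_orientation G \<O> \<and> cycle_neutral G \<O>}"
proof -
  let ?a = "exponential_parameters G"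
  let ?U = "zero_sum_space - \<Union>(bigraphical_arrangement G ?a)"
  note real = region_realises[OF assms]
  have nonempty: "\<exists>x. x \<in> R" if "R \<in> regions (bigraphical_arrangement G ?a)" for R
    using that in_components_nonempty unfolding regions_def by blast
  show ?thesis
  proof (intro bij_betwI')
    fix R S
    assume R: "R \<in> regions (bigraphical_arrangement G ?a)"
      and S: "S \<in> regions (bigraphical_arrangement G ?a)"
    show "region_orientation G ?a R = region_orientation G ?a S \<longleftrightarrow> R = S"
    proof
      assume eq: "region_orientation G ?a R = region_orientation G ?a S"
      obtain x y where x: "x \<in> R" and y: "y \<in> S"
        using nonempty R S by blast
      have sub: "R \<subseteq> ?U" "S \<subseteq> ?U"
        using R S in_components_subset unfolding regions_def by blast+
      \<comment> \<open>Injectivity: a connected subset of the complement joins the two points, and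
        meeting both components it forces them to coincide.\<close>
      have "connected_component ?U x y"
        using real[OF R x] real[OF S y] x y sub eq
        by (intro connected_component_if_same_orientation[OF assms]) auto
      then obtain T where "connected T" "T \<subseteq> ?U" "x \<in> T" "y \<in> T"
        unfolding connected_component_def by blast
      with R S x y show "R = S"
        unfolding regions_def by (intro joinable_components_eq[of T ?U]) blast
    qed simp
  next
    fix R assume R: "R \<in> regions (bigraphical_arrangement G ?a)"
    with nonempty obtain x where "x \<in> R" by blast
    from real[OF R this]
    show "region_orientation G ?a R \<in> {\<O>. partial_orientation G \<O> \<and> cycle_neutral G \<O>}"
      using realises_imp_partial_orientation realises_imp_cycle_neutral[OF assms] by blast
  next
    fix \<O> assume "\<O> \<in> {\<O>. partial_orientation G \<O> \<and> cycle_neutral G \<O>}"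
    then obtain x where x: "x \<in> zero_sum_space" "realises G x \<O>"
      using cycle_neutral_imp_realises[OF assms] realises_zero_sum by blast
    then have xU: "x \<in> ?U"
      by (subst mem_complement_iff[OF assms]) (simp add: realises_def)
    \<comment> \<open>Surjectivity: the component of a realising point works, because that point
      realises both \<open>\<O>\<close> and the orientation of its region, and a point realises only
      one orientation.\<close>
    define R where "R = connected_component_set ?U x"
    have R: "R \<in> regions (bigraphical_arrangement G ?a)"
      using xU by (auto simp: R_def regions_def components_def)
    moreover have "x \<in> R"
      using xU by (simp add: R_def)
    ultimately show "\<exists>R\<in>regions (bigraphical_arrangement G ?a). \<O> = region_orientation G ?a R"
      using realises_unique[OF x(2) real] by blast
  qed
qed

end
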